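(* Let $q$ be a prime power, let $n,\ell,m\ge 1$ and $d\ge 0$ be integers, let $Y\subset\mathbb{F}_q^n$, and let $X=\mathrm{cl}_d^{\ell,m}(Y)$. Then $$ {}^a\mathrm{HF}^\ell(\mathbb{F}_q^n,d)\,|X| \leq q^n\binom{m+n-1}{n}|Y|. $$
   Context: $\mathbb{F}_q$ is the finite field with $q$ elements. For a field $k$, let $A=k[x_1,\dots,x_n]$, and for a set $J\subset A$ let $J_{\le d}$ be the set of polynomials in $J$ of total degree at most $d$. A polynomial $P\in A$ vanishes with multiplicity (to order) at least $m$ at a point $p\in k^n$ if $P\in (x_1-p_1,\dots,x_n-p_n)^m$. For $X\subset k^n$, $I^m(X)\subset A$ is the ideal of polynomials vanishing with multiplicity at least $m$ at every point of $X$, and ${}^a\mathrm{HF}^m(X,d)=\dim_k A_{\le d}/I^m(X)_{\le d}$. For $Y\subset k^n$, $\mathrm{cl}_d^{\ell,m}(Y)$ is the set of points $x\in k^n$ such that every polynomial of degree at most $d$ vanishing with multiplicity at least $m$ at each point of $Y$ vanishes with multiplicity at least $\ell$ at $x$. Here $k=\mathbb{F}_q$. *)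

theory Defs
  imports
    "HOL-Library.Poly_Mapping"
    "HOL-Library.Set_Algebras"
    "HOL-Analysis.Finite_Cartesian_Product"
    "HOL-Algebra.Ideal_Product"
    "Jordan_Normal_Form.VS_Connect"
begin

section \<open>Polynomials in variables indexed by a type\<close>

text \<open>The multiplication of \<^typ>\<open>('n \<Rightarrow>\<^sub>0 nat) \<Rightarrow>\<^sub>0 'k\<close> is convolution, so for a finite type
  \<open>'n\<close> this is the polynomial ring over \<open>'k\<close> in \<open>CARD('n)\<close> variables, an element mapping
  each exponent vector to its coefficient.\<close>

type_synonym ('n, 'k) mpoly = "('n \<Rightarrow>\<^sub>0 nat) \<Rightarrow>\<^sub>0 'k"

definition Const :: "'k::comm_ring_1 \<Rightarrow> ('n, 'k) mpoly"
  where "Const c = Poly_Mapping.single 0 c"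

definition Var :: "'n \<Rightarrow> ('n, 'k::comm_ring_1) mpoly"
  where "Var i = Poly_Mapping.single (Poly_Mapping.single i 1) 1"

text \<open>The zero polynomial has no exponent vectors and therefore lies in every
  \<open>deg_le J d\<close> with \<open>0 \<in> J\<close>.\<close>

definition deg_le :: "('n::finite, 'k::comm_ring_1) mpoly set \<Rightarrow> nat \<Rightarrow> ('n, 'k) mpoly set"
  where "deg_le J d = {P \<in> J. \<forall>t \<in> Poly_Mapping.keys P. (\<Sum>i\<in>UNIV. Poly_Mapping.lookup t i) \<le> d}"

section \<open>Vanishing with multiplicity\<close>

text \<open>\<^term>\<open>class_ring\<close> is the whole type, viewed as a ring with a carrier set. The ideals of a
  ring form the multiplicative monoid \<^term>\<open>ideals_set R\<close>, whose powers are the powers of ideals.\<close>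

definition point_ideal :: "'k::field ^ 'n::finite \<Rightarrow> ('n, 'k) mpoly set"
  where "point_ideal p = genideal class_ring (range (\<lambda>i. Var i - Const (vec_nth p i)))"

definition vanishes_to_order :: "nat \<Rightarrow> 'k::field ^ 'n::finite \<Rightarrow> ('n, 'k) mpoly \<Rightarrow> bool"
  where "vanishes_to_order m p P \<longleftrightarrow> P \<in> point_ideal p [^]\<^bsub>ideals_set class_ring\<^esub> m"

definition mult_ideal :: "nat \<Rightarrow> ('k::field ^ 'n::finite) set \<Rightarrow> ('n, 'k) mpoly set"
  where "mult_ideal m X = {P. \<forall>p\<in>X. vanishes_to_order m p P}"

definition mult_closure ::
    "nat \<Rightarrow> nat \<Rightarrow> nat \<Rightarrow> ('k::field ^ 'n::finite) set \<Rightarrow> ('k ^ 'n) set"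
  where "mult_closure d l m Y = {x. \<forall>P \<in> deg_le (mult_ideal m Y) d. vanishes_to_order l x P}"

section \<open>Dimension of a quotient space and affine Hilbert functions\<close>

text \<open>The quotient of \<open>V\<close> by \<open>W\<close>, where \<open>W \<subseteq> V\<close> are both closed under addition and under
  \<open>sc\<close>. The elements are the cosets of \<open>W\<close>. Since the image of a coset under \<open>sc 0\<close> is
  \<open>{0}\<close> rather than \<open>W\<close>, scalar multiplication adds \<open>W\<close> again. The module record extends the
  ring record, so it has a multiplication and a unit; these play no role for vector spaces.\<close>

definition quotient_space ::
    "('k \<Rightarrow> 'v \<Rightarrow> 'v) \<Rightarrow> 'v::ab_group_add set \<Rightarrow> 'v set \<Rightarrow> ('k, 'v set) module"
  where "quotient_space sc V W =
    \<lparr>carrier = (\<lambda>v. v +o W) ` V, mult = undefined, one = undefined,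
     zero = W, add = (+), smult = (\<lambda>c C. sc c ` C + W)\<rparr>"

lemma coset_add:
  fixes W :: "'v::ab_group_add set"
  assumes "\<And>x y. x \<in> W \<Longrightarrow> y \<in> W \<Longrightarrow> x + y \<in> W" "0 \<in> W"
  shows "(v +o W) + (w +o W) = (v + w) +o W"
proof -
  have "W + W = W"
    using assms by (force simp: set_plus_def)
  then show ?thesis
    by (metis set_plus_rearrange)
qed

lemma coset_scale:
  assumes "vector_space sc" "module.subspace sc W"
  shows "sc c ` (v +o W) + W = sc c v +o W"
proof -
  interpret vector_space sc by fact
  have W: "x + y \<in> W" "sc a x \<in> W" "x - y \<in> W" "0 \<in> W" if "x \<in> W" "y \<in> W" for x y a
    using assms(2) that by (auto simp: subspace_add subspace_scale subspace_diff subspace_0)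
  show ?thesis
  proof (intro equalityI subsetI)
    fix z assume "z \<in> sc c ` (v +o W) + W"
    then obtain x y where "x \<in> W" "y \<in> W" "z = sc c (v + x) + y"
      by (auto simp: set_plus_def elt_set_plus_def)
    then show "z \<in> sc c v +o W"
      using W by (auto simp: elt_set_plus_def scale_right_distrib add.assoc)
  next
    fix z assume "z \<in> sc c v +o W"
    then obtain y where "y \<in> W" "z = sc c v + y"
      by (auto simp: elt_set_plus_def)
    moreover have "v \<in> v +o W"
      using W(4)[OF \<open>y \<in> W\<close> \<open>y \<in> W\<close>] by (force simp: elt_set_plus_def)
    ultimately show "z \<in> sc c ` (v +o W) + W"
      by (auto simp: set_plus_def)
  qed
qed

lemma vectorspace_quotient_space:
  fixes sc :: "'k::field \<Rightarrow> 'v::ab_group_add \<Rightarrow> 'v"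
  assumes sc: "vector_space sc" and V: "module.subspace sc V" and W: "module.subspace sc W"
  shows "vectorspace class_ring (quotient_space sc V W)"
proof -
  interpret vector_space sc by fact
  have add: "(v +o W) + (w +o W) = (v + w) +o W" for v w
    using W by (intro coset_add) (auto simp: subspace_add subspace_0)
  define S where "S = (\<lambda>c C. sc c ` C + W)"
  have scl: "S c (v +o W) = sc c v +o W" for c v
    using coset_scale[OF sc W] by (simp add: S_def)
  have zero: "W = 0 +o W"
    by (simp add: elt_set_plus_def)
  let ?Q = "quotient_space sc V W"
  have "abelian_group ?Q"
  proof (rule abelian_groupI)
    fix C assume "C \<in> carrier ?Q"
    then obtain v where "v \<in> V" "C = v +o W"
      by (auto simp: quotient_space_def)
    then show "\<exists>D\<in>carrier ?Q. D \<oplus>\<^bsub>?Q\<^esub> C = \<zero>\<^bsub>?Q\<^esub>"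
      using V zero
      by (intro bexI[of _ "(- v) +o W"])
        (auto simp: quotient_space_def add subspace_neg)
    show "\<zero>\<^bsub>?Q\<^esub> \<oplus>\<^bsub>?Q\<^esub> C = C"
      using add[of 0 v] \<open>C = v +o W\<close> zero by (simp add: quotient_space_def)
  next
    show "\<zero>\<^bsub>?Q\<^esub> \<in> carrier ?Q"
      using zero subspace_0[OF V] by (force simp: quotient_space_def)
  qed (use V in \<open>auto simp: quotient_space_def add subspace_add ac_simps\<close>)
  moreover have "Module.module class_ring ?Q"
    by (rule module.intro[OF class_cring.is_cring calculation], unfold_locales)
      (use V in \<open>auto simp: quotient_space_def add scl subspace_scale
        scale_left_distrib scale_right_distrib simp flip: S_def\<close>)
  ultimately show ?thesis
    by (simp add: vectorspace_def class_field)
qed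

definition affine_HF :: "nat \<Rightarrow> ('k::field ^ 'n::finite) set \<Rightarrow> nat \<Rightarrow> nat"
  where "affine_HF m X d =
    vectorspace.dim (class_ring :: 'k ring)
      (quotient_space (\<lambda>c P. Const c * P) (deg_le UNIV d) (deg_le (mult_ideal m X) d))"

text \<open>The two spaces in \<^term>\<open>affine_HF m X d\<close> are vector spaces over the base field, so the
  dimension is taken of a genuine vector space.\<close>

lemma vector_space_Const_times:
  "vector_space (\<lambda>c (P :: ('n, 'k::field) mpoly). Const c * P)"
  by unfold_locales
    (simp_all add: Const_def single_add algebra_simps Poly_Mapping.mult_single flip: mult.assoc)

lemma ideal_power_point_ideal:
  "ideal (point_ideal p [^]\<^bsub>ideals_set class_ring\<^esub> (m::nat)) class_ring"
proof (induction m)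
  case 0
  then show ?case
    using ring.oneideal[OF class_ring.ring_axioms] by (simp add: ideals_set_def nat_pow_def)
next
  case (Suc m)
  have "ideal (point_ideal p) class_ring"
    unfolding point_ideal_def by (rule ring.genideal_ideal[OF class_ring.ring_axioms]) simp
  with Suc show ?case
    using ring.ideal_prod_is_ideal[OF class_ring.ring_axioms]
    by (simp add: ideals_set_def nat_pow_def)
qed

lemma mult_ideal_closed:
  shows "0 \<in> mult_ideal m X"
    and "P \<in> mult_ideal m X \<Longrightarrow> Q \<in> mult_ideal m X \<Longrightarrow> P + Q \<in> mult_ideal m X"
    and "Q \<in> mult_ideal m X \<Longrightarrow> R * Q \<in> mult_ideal m X"
proof -
  note I = ideal_power_point_ideal[where m = m]
  note 1 = additive_subgroup.zero_closed[OF ideal.axioms(1)[OF I]]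
    and 2 = additive_subgroup.a_closed[OF ideal.axioms(1)[OF I]]
    and 3 = ideal.I_l_closed[OF I]
  show "0 \<in> mult_ideal m X"
    by (simp add: 1[simplified] mult_ideal_def vanishes_to_order_def)
  show "P + Q \<in> mult_ideal m X" if "P \<in> mult_ideal m X" "Q \<in> mult_ideal m X"
    using that by (simp add: 2[simplified] mult_ideal_def vanishes_to_order_def)
  show "R * Q \<in> mult_ideal m X" if "Q \<in> mult_ideal m X"
    using that by (simp add: 3[simplified] mult_ideal_def vanishes_to_order_def)
qed

lemma subspace_deg_le:
  fixes J :: "('n::finite, 'k::field) mpoly set"
  assumes "0 \<in> J" "\<And>P Q. P \<in> J \<Longrightarrow> Q \<in> J \<Longrightarrow> P + Q \<in> J" "\<And>P R. P \<in> J \<Longrightarrow> R * P \<in> J"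
  shows "module.subspace (\<lambda>c P. Const c * P) (deg_le J d)"
proof -
  interpret vector_space "\<lambda>c (P :: ('n, 'k) mpoly). Const c * P"
    by (rule vector_space_Const_times)
  have "Poly_Mapping.keys (Const c * P) \<subseteq> Poly_Mapping.keys P" for c and P :: "('n, 'k) mpoly"
    using keys_mult[of "Const c" P] by (auto simp: Const_def split: if_splits)
  then show ?thesis
    using assms Poly_Mapping.keys_add by (fastforce simp: subspace_def deg_le_def)
qed

lemma vectorspace_affine_HF:
  "vectorspace class_ring
    (quotient_space (\<lambda>c P. Const c * P) (deg_le UNIV d) (deg_le (mult_ideal m X) d))"
  by (intro vectorspace_quotient_space vector_space_Const_times subspace_deg_le)
    (simp_all add: mult_ideal_closed)

end

theory Submission
  imports Defs "HOL-Algebra.QuotRing"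
begin

text \<open>
  For a fixed degree and multiplicity the affine Hilbert function \<open>f S\<close> is a submodular function of
  the point set \<open>S\<close>, vanishes on the empty set and is invariant under translations of \<open>k^n\<close>. The
  translates of \<open>X\<close> cover every point exactly \<open>card X\<close> times, and a submodular function satisfies
  the fractional covering inequality, so \<open>card X * f (k^n) \<le> q^n * f X\<close>. By definition of the
  closure, \<open>f X\<close> (multiplicity \<open>l\<close>) is at most the Hilbert function of \<open>Y\<close> with multiplicity
  \<open>m\<close>, which by subadditivity is at most \<open>card Y\<close> times the number of monomials of degree below
  \<open>m\<close>. Since \<open>k\<close> is finite, dimensions are read off from cardinalities:
  submodularity, for instance, is obtained by counting the fibres of the subtraction map on pairs
  of polynomials.
\<close>

section \<open>Polynomials of bounded degree\<close>

text \<open>Turns a degree bound into an inclusion \<open>keys P \<subseteq> exponents d\<close>,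
  which passes through sums, products and powers without a separate case for the zero
  polynomial.\<close>

definition exponents :: "nat \<Rightarrow> ('n::finite \<Rightarrow>\<^sub>0 nat) set"
  where "exponents d = {t. (\<Sum>i\<in>UNIV. Poly_Mapping.lookup t i) \<le> d}"

lemma mem_deg_le_iff: "P \<in> deg_le J d \<longleftrightarrow> P \<in> J \<and> Poly_Mapping.keys P \<subseteq> exponents d"
  by (auto simp: deg_le_def exponents_def)

text \<open>Stars and bars: padding an exponent vector with copies of the extra symbol
  \<open>None\<close> up to total \<open>d\<close> makes it a multiset of size exactly
  \<open>d\<close> over the n + 1 elements of \<open>'n option\<close>. Forgetting the padding maps
  these multisets onto a set containing all of \<open>exponents d\<close>.\<close>

lemma exponents_card:
  "finite (exponents d :: ('n::finite \<Rightarrow>\<^sub>0 nat) set)"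
  "card (exponents d :: ('n \<Rightarrow>\<^sub>0 nat) set) \<le> (d + CARD('n)) choose CARD('n)"
proof -
  let ?M = "multisets_of_size (UNIV :: 'n option set) d"
  define f :: "'n option multiset \<Rightarrow> 'n \<Rightarrow>\<^sub>0 nat"
    where "f = (\<lambda>M. Abs_poly_mapping (\<lambda>i. count M (Some i)))"
  have sub: "exponents d \<subseteq> f ` ?M"
  proof
    fix t :: "'n \<Rightarrow>\<^sub>0 nat" assume "t \<in> exponents d"
    then have le: "(\<Sum>i\<in>UNIV. Poly_Mapping.lookup t i) \<le> d" by (simp add: exponents_def)
    define M where "M = (\<Sum>i\<in>UNIV. replicate_mset (Poly_Mapping.lookup t i) (Some i))
      + replicate_mset (d - (\<Sum>i\<in>UNIV. Poly_Mapping.lookup t i)) None"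
    have "count M (Some i) = Poly_Mapping.lookup t i" for i
      by (simp add: M_def count_sum sum.delta)
    then have "f M = t" by (simp add: f_def)
    moreover have "M \<in> ?M"
      using le by (simp add: multisets_of_size_def M_def size_multiset_sum)
    ultimately show "t \<in> f ` ?M" by blast
  qed
  have fin: "finite ?M" by (rule finite_multisets_of_size) simp
  show "finite (exponents d :: ('n \<Rightarrow>\<^sub>0 nat) set)"
    using sub fin finite_surj by blast
  have "card (exponents d :: ('n \<Rightarrow>\<^sub>0 nat) set) \<le> card ?M"
    by (rule surj_card_le[OF fin sub])
  also have "\<dots> = (CARD('n) + d) choose d"
    by (simp add: card_multisets_of_size)
  also have "\<dots> = (d + CARD('n)) choose CARD('n)"
    using binomial_symmetric[of d "CARD('n) + d"] by (simp add: add.commute)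
  finally show "card (exponents d :: ('n \<Rightarrow>\<^sub>0 nat) set) \<le> (d + CARD('n)) choose CARD('n)" .
qed

lemma polys_with_keys_card:
  fixes T :: "('n \<Rightarrow>\<^sub>0 nat) set"
  assumes "finite T"
  shows "finite {P :: ('n, 'k::{finite,field}) mpoly. Poly_Mapping.keys P \<subseteq> T}"
    and "card {P :: ('n, 'k) mpoly. Poly_Mapping.keys P \<subseteq> T} \<le> CARD('k) ^ card T"
proof -
  let ?S = "{P :: ('n, 'k) mpoly. Poly_Mapping.keys P \<subseteq> T}"
  let ?F = "T \<rightarrow>\<^sub>E (UNIV :: 'k set)"
  have inj: "inj_on (\<lambda>P. restrict (Poly_Mapping.lookup P) T) ?S"
  proof (rule inj_onI)
    fix P Q :: "('n, 'k) mpoly"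
    assume PQ: "P \<in> ?S" "Q \<in> ?S"
      "restrict (Poly_Mapping.lookup P) T = restrict (Poly_Mapping.lookup Q) T"
    have "Poly_Mapping.lookup P t = Poly_Mapping.lookup Q t" for t
    proof (cases "t \<in> T")
      case True
      then show ?thesis using PQ(3) by (metis restrict_apply')
    next
      case False
      then have "t \<notin> Poly_Mapping.keys P" "t \<notin> Poly_Mapping.keys Q" using PQ(1,2) by auto
      then show ?thesis by (simp add: in_keys_iff)
    qed
    then show "P = Q" by (rule poly_mapping_eqI)
  qed
  have sub: "(\<lambda>P. restrict (Poly_Mapping.lookup P) T) ` ?S \<subseteq> ?F" by auto
  have fin: "finite ?F" using assms by (simp add: finite_PiE)
  show "finite ?S" using inj_on_finite[OF inj sub fin] .
  have "card ?S \<le> card ?F" by (rule card_inj_on_le[OF inj sub fin])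
  then show "card ?S \<le> CARD('k) ^ card T" using assms by (simp add: card_funcsetE)
qed

lemma finite_deg_le: "finite (deg_le J d :: ('n::finite, 'k::{finite,field}) mpoly set)"
  by (rule finite_subset[OF _ polys_with_keys_card(1)[OF exponents_card(1)[of d]]])
    (auto simp: mem_deg_le_iff)

lemma keys_times:
  "Poly_Mapping.keys P \<subseteq> exponents a \<Longrightarrow> Poly_Mapping.keys Q \<subseteq> exponents b \<Longrightarrow>
    Poly_Mapping.keys (P * Q) \<subseteq> exponents (a + b)"
  using keys_mult[of P Q]
  by (fastforce simp: exponents_def lookup_add sum.distrib intro: add_mono)

lemma keys_power: "Poly_Mapping.keys (P :: ('n::finite, 'k::comm_ring_1) mpoly) \<subseteq> exponents 1
  \<Longrightarrow> Poly_Mapping.keys (P ^ k) \<subseteq> exponents k"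
proof (induction k)
  case 0
  then show ?case by (simp add: exponents_def)
next
  case (Suc k)
  then show ?case using keys_times[of P 1 "P ^ k" k] by simp
qed

lemma keys_prod: "finite I \<Longrightarrow> (\<And>i. i \<in> I \<Longrightarrow> Poly_Mapping.keys (f i) \<subseteq> exponents (a i))
  \<Longrightarrow> Poly_Mapping.keys (\<Prod>i\<in>I. f i :: ('n::finite, 'k::comm_ring_1) mpoly) \<subseteq> exponents (\<Sum>i\<in>I. a i)"
proof (induction I rule: finite_induct)
  case empty
  then show ?case by (simp add: exponents_def)
next
  case (insert x F)
  then show ?case using keys_times[of "f x" "a x" "prod f F" "sum a F"] by simp
qed

section \<open>Expansion into monomials and constants\<close>

lemma expand_monomials:
  "(P :: 'a \<Rightarrow>\<^sub>0 'b::comm_monoid_add) =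
    (\<Sum>t\<in>Poly_Mapping.keys P. Poly_Mapping.single t (Poly_Mapping.lookup P t))"
  by (rule poly_mapping_eqI)
    (auto simp: lookup_sum lookup_single when_def in_keys_iff)

lemma monomial_induct [case_names zero add single]:
  fixes P :: "'a \<Rightarrow>\<^sub>0 'b::comm_monoid_add"
  assumes "\<Phi> 0" "\<And>P Q. \<Phi> P \<Longrightarrow> \<Phi> Q \<Longrightarrow> \<Phi> (P + Q)" "\<And>t c. \<Phi> (Poly_Mapping.single t c)"
  shows "\<Phi> P"
proof -
  have "\<Phi> (\<Sum>t\<in>T. Poly_Mapping.single t (Poly_Mapping.lookup P t))" if "finite T" for T
    using that by induction (auto intro: assms)
  then show ?thesis using expand_monomials[of P] by (metis finite_keys)
qed

lemma Const_add: "Const (a + b) = Const a + Const b"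
  by (simp add: Const_def single_add)

lemma Const_diff: "Const (a - b) = Const a - Const b"
  by (simp add: Const_def single_diff)

lemma Const_mult: "Const (a * b) = Const a * Const b"
  by (simp add: Const_def Poly_Mapping.mult_single)

lemma Const_1: "Const 1 = 1"
  by (simp add: Const_def)

lemma Var_power: "(Var i :: ('n, 'k::comm_ring_1) mpoly) ^ k = Poly_Mapping.single (Poly_Mapping.single i k) 1"
  by (induction k) (simp_all add: Var_def Poly_Mapping.mult_single flip: single_add)

text \<open>Expresses a monomial through ring operations, so that a ring homomorphism can be
  evaluated on it from its values on constants and variables.\<close>

lemma single_eq_prod:
  "Poly_Mapping.single t c =
    Const c * (\<Prod>i\<in>UNIV. (Var i :: ('n::finite, 'k::comm_ring_1) mpoly) ^ Poly_Mapping.lookup t i)"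
proof -
  have "(\<Prod>i\<in>I. (Var i :: ('n, 'k) mpoly) ^ Poly_Mapping.lookup t i)
    = Poly_Mapping.single (\<Sum>i\<in>I. Poly_Mapping.single i (Poly_Mapping.lookup t i)) 1"
    if "finite I" for I
    using that by induction (simp_all add: Var_power Poly_Mapping.mult_single)
  moreover have "(\<Sum>i\<in>UNIV. Poly_Mapping.single i (Poly_Mapping.lookup t i)) = t"
    by (rule poly_mapping_eqI) (simp add: lookup_sum lookup_single when_def)
  ultimately show ?thesis by (simp add: Const_def Poly_Mapping.mult_single)
qed

section \<open>Translations\<close>

text \<open>This is the substitution P(x + g), so vanishing at \<open>p\<close> becomes vanishing at
  \<open>p - g\<close>.\<close>

definition translate :: "'k::field ^ 'n::finite \<Rightarrow> ('n, 'k) mpoly \<Rightarrow> ('n, 'k) mpoly"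
  where "translate g P = (\<Sum>t\<in>Poly_Mapping.keys P. Const (Poly_Mapping.lookup P t) *
    (\<Prod>i\<in>UNIV. (Var i + Const (vec_nth g i)) ^ Poly_Mapping.lookup t i))"

text \<open>Exponents outside \<open>keys P\<close> contribute zero terms, so \<open>P\<close>,
  \<open>Q\<close> and \<open>P + Q\<close> can be summed over one common index set.\<close>

lemma translate_superset:
  assumes "finite T" "Poly_Mapping.keys P \<subseteq> T"
  shows "translate g P = (\<Sum>t\<in>T. Const (Poly_Mapping.lookup P t) *
    (\<Prod>i\<in>UNIV. (Var i + Const (vec_nth g i)) ^ Poly_Mapping.lookup t i))"
  unfolding translate_def using assms
  by (intro sum.mono_neutral_left) (auto simp: in_keys_iff Const_def)

lemma translate_add: "translate g (P + Q) = translate g P + translate g Q"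
proof -
  let ?T = "Poly_Mapping.keys P \<union> Poly_Mapping.keys Q"
  have "Poly_Mapping.keys (P + Q) \<subseteq> ?T" by (rule Poly_Mapping.keys_add)
  then show ?thesis
    by (simp add: translate_superset[of ?T] lookup_add Const_add distrib_right sum.distrib)
qed

lemma translate_0: "translate g 0 = 0"
  by (simp add: translate_def)

lemma translate_single: "translate g (Poly_Mapping.single t c) =
    Const c * (\<Prod>i\<in>UNIV. (Var i + Const (vec_nth g i)) ^ Poly_Mapping.lookup t i)"
  by (subst translate_superset[of "{t}"]) (auto simp: Const_def)

lemma translate_mult: "translate g (P * Q) = translate g P * translate g Q"
proof (induction P rule: monomial_induct)
  case (single t c)
  show ?case
  proof (induction Q rule: monomial_induct)
    case (single s b)
    show ?case
      by (simp add: Poly_Mapping.mult_single translate_single Const_mult lookup_add power_add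
        prod.distrib ac_simps)
  qed (simp_all add: translate_0 translate_add distrib_left)
qed (simp_all add: translate_0 translate_add distrib_right)

lemma translate_Const: "translate g (Const c) = Const c"
  using translate_single[of g 0 c] by (simp add: Const_def)

lemma translate_Var: "translate g (Var i) = Var i + Const (vec_nth g i)"
proof -
  have "(\<Prod>j\<in>UNIV. (Var j + Const (vec_nth g j)) ^ Poly_Mapping.lookup (Poly_Mapping.single i 1) j)
     = (\<Prod>j\<in>UNIV. if j = i then Var i + Const (vec_nth g i) else 1)"
    by (intro prod.cong) (auto simp: lookup_single when_def)
  then show ?thesis
    by (simp add: Var_def translate_single Const_1)
qed

lemma translate_power: "translate g (P ^ k) = translate g P ^ k"
  using translate_Const[of g 1] by (induction k) (simp_all add: translate_mult Const_1)

lemma translate_prod: "translate g (\<Prod>i\<in>I. f i) = (\<Prod>i\<in>I. translate g (f i))"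
  using translate_Const[of g 1]
  by (induction I rule: infinite_finite_induct) (simp_all add: translate_mult Const_1)

text \<open>Supplies the injectivity of translations. As \<open>translate (- g)\<close> respects
  sums, products and powers, it is enough that it sends each factor x_i + g_i back to x_i.\<close>

lemma translate_uminus: "translate (- g) (translate g P) = P"
proof (induction P rule: monomial_induct)
  case (single t c)
  have "translate (- g) (Var i + Const (vec_nth g i)) = Var i" for i
    by (simp add: translate_add translate_Var translate_Const flip: Const_add)
      (simp add: add.assoc Const_def flip: single_add)
  then show ?case
    by (simp add: translate_single translate_mult translate_Const translate_prod translate_power
      flip: single_eq_prod)
qed (simp_all add: translate_0 translate_add)

lemma keys_translate:
  fixes P :: "('n::finite, 'k::field) mpoly"
  assumes "Poly_Mapping.keys P \<subseteq> exponents d"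
  shows "Poly_Mapping.keys (translate g P) \<subseteq> exponents d"
proof -
  have lin: "Poly_Mapping.keys (Var i + Const c :: ('n, 'k) mpoly) \<subseteq> exponents 1"
    for i :: 'n and c :: 'k
    using Poly_Mapping.keys_add[of "Var i" "Const c"]
    by (auto simp: Var_def Const_def exponents_def lookup_single when_def split: if_splits)
  have const: "Poly_Mapping.keys (Const c :: ('n, 'k) mpoly) \<subseteq> exponents 0" for c :: 'k
    by (auto simp: Const_def exponents_def)
  have "Poly_Mapping.keys (Const (Poly_Mapping.lookup P t) *
    (\<Prod>i\<in>UNIV. (Var i + Const (vec_nth g i)) ^ Poly_Mapping.lookup t i)) \<subseteq> exponents d"
    if "t \<in> Poly_Mapping.keys P" for t
  proof -
    \<comment> \<open>The summand 0 is the degree of the coefficient; the i-th factor is linear and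
      contributes its exponent.\<close>
    have "exponents (0 + (\<Sum>i\<in>UNIV. Poly_Mapping.lookup t i)) \<subseteq> exponents d"
      using assms that by (auto simp: exponents_def)
    then show ?thesis
      by (rule subset_trans[OF keys_times[OF const
            keys_prod[OF finite_class.finite_UNIV keys_power[OF lin]]]])
  qed
  then show ?thesis
    unfolding translate_def by (intro subset_trans[OF keys_sum] UN_least)
qed

lemma ring_hom_translate:
  "ring_hom_ring (class_ring :: ('n::finite, 'k::field) mpoly ring) class_ring (translate g)"
  using translate_Const[of g 1]
  by (intro ring_hom_ringI2 class_ring.ring_axioms ring_hom_memI)
    (simp_all add: translate_add translate_mult Const_1)

text \<open>The preimage \<open>?J\<close> of the target ideal under a ring homomorphism is an
  ideal. It contains every generator x_i - p_i of \<open>point_ideal p\<close>, because this is sent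
  to the generator x_i - (p - g)_i, so minimality of the generated ideal applies.\<close>

lemma translate_point_ideal:
  assumes "P \<in> point_ideal p"
  shows "translate g P \<in> point_ideal (p - g)"
proof -
  interpret ring_hom_ring class_ring class_ring "translate g"
    by (rule ring_hom_translate)
  let ?J = "{P \<in> carrier class_ring. translate g P \<in> point_ideal (p - g)}"
  have "ideal (point_ideal (p - g)) class_ring"
    unfolding point_ideal_def by (rule ring.genideal_ideal[OF class_ring.ring_axioms]) simp
  then have "ideal ?J class_ring" by (rule ideal_vimage)
  moreover have "Var i - Const (vec_nth p i) \<in> ?J" for i
  proof -
    have "translate g (Var i - Const (vec_nth p i)) = Var i - Const (vec_nth (p - g) i)"
      using translate_add[of g "Var i - Const (vec_nth p i)" "Const (vec_nth p i)"]
      by (simp add: translate_Var translate_Const Const_diff algebra_simps)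
    moreover have "Var i - Const (vec_nth (p - g) i) \<in> point_ideal (p - g)"
      unfolding point_ideal_def
      using ring.genideal_self[OF class_ring.ring_axioms,
          of "Set.range (\<lambda>i. Var i - Const (vec_nth (p - g) i))"] by auto
    ultimately show ?thesis by simp
  qed
  ultimately have "point_ideal p \<subseteq> ?J"
    unfolding point_ideal_def
    by (intro ring.genideal_minimal[OF class_ring.ring_axioms]) auto
  then show ?thesis using assms by auto
qed

section \<open>Order of vanishing under translation and at the origin\<close>

lemma vanishes_to_order_0: "vanishes_to_order 0 p P"
  by (simp add: vanishes_to_order_def ideals_set_def nat_pow_def)

lemma vanishes_to_order_Suc:
  "vanishes_to_order (Suc m) p P \<longleftrightarrow>
    P \<in> ideal_prod class_ring {Q. vanishes_to_order m p Q} (point_ideal p)"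
  by (simp add: vanishes_to_order_def ideals_set_def nat_pow_def)

lemma vanishes_to_order_add:
  "vanishes_to_order m p P \<Longrightarrow> vanishes_to_order m p Q \<Longrightarrow> vanishes_to_order m p (P + Q)"
  using mult_ideal_closed(2)[of P m "{p}" Q] by (simp add: mult_ideal_def)

text \<open>The power m + 1 is the ideal product of the m-th power with
  \<open>point_ideal p\<close>. Rule induction over that product leaves single products, settled
  factor by factor, and sums.\<close>

lemma vanishes_to_order_translate:
  "vanishes_to_order m p P \<Longrightarrow> vanishes_to_order m (p - g) (translate g P)"
proof (induction m arbitrary: P)
  case 0
  show ?case by (rule vanishes_to_order_0)
next
  case (Suc m)
  have "P \<in> ideal_prod class_ring {Q. vanishes_to_order m p Q} (point_ideal p)"
    using Suc.prems by (simp add: vanishes_to_order_Suc)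
  then show ?case
  proof induction
    case (prod i j)
    then have "vanishes_to_order m (p - g) (translate g i)" "translate g j \<in> point_ideal (p - g)"
      using Suc.IH translate_point_ideal by auto
    then show ?case
      using ideal_prod.prod[of "translate g i" _ "translate g j" _ class_ring]
      by (simp add: vanishes_to_order_Suc translate_mult)
  next
    case (sum s1 s2)
    then show ?case by (simp add: translate_add vanishes_to_order_add)
  qed
qed

text \<open>One variable is split off at a time: x_i lies in the ideal of the origin and the
  remaining monomial has degree one less.\<close>

lemma vanishes_to_order_monomial:
  "m \<le> (\<Sum>i\<in>UNIV. Poly_Mapping.lookup t i) \<Longrightarrow>
    vanishes_to_order m (0 :: 'k::field ^ 'n::finite) (Poly_Mapping.single t c)"
proof (induction m arbitrary: t)
  case 0
  show ?case by (rule vanishes_to_order_0)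
next
  case (Suc m)
  then obtain i where i: "Poly_Mapping.lookup t i > 0"
    by (metis (no_types, lifting) neq0_conv not_less_eq_eq zero_le sum.neutral)
  define s where "s = t - Poly_Mapping.single i 1"
  have t: "t = s + Poly_Mapping.single i (Suc 0)"
    using i by (intro poly_mapping_eqI) (auto simp: s_def lookup_add lookup_minus lookup_single when_def)
  have "(\<Sum>i\<in>UNIV. Poly_Mapping.lookup t i) = (\<Sum>i\<in>UNIV. Poly_Mapping.lookup s i) + 1"
    by (simp add: t lookup_add sum.distrib lookup_single when_def)
  then have "vanishes_to_order m (0 :: 'k ^ 'n) (Poly_Mapping.single s c)"
    using Suc by simp
  moreover have "Var i \<in> point_ideal (0 :: 'k ^ 'n)"
    using ring.genideal_self[OF class_ring.ring_axioms,
      of "Set.range (\<lambda>i. Var i - Const (vec_nth (0 :: 'k ^ 'n) i))"]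
    by (auto simp: point_ideal_def Const_def)
  ultimately show ?case
    using ideal_prod.prod[of "Poly_Mapping.single s c" _ "Var i" _ class_ring]
    by (simp add: vanishes_to_order_Suc Var_def Poly_Mapping.mult_single flip: t)
qed

lemma vanishes_to_order_origin:
  assumes "\<And>t. t \<in> Poly_Mapping.keys P \<Longrightarrow> m \<le> (\<Sum>i\<in>UNIV. Poly_Mapping.lookup t i)"
  shows "vanishes_to_order m (0 :: 'k::field ^ 'n::finite) P"
proof -
  have "vanishes_to_order m (0 :: 'k ^ 'n)
      (\<Sum>t\<in>T. Poly_Mapping.single t (Poly_Mapping.lookup P t))"
    if "finite T" "T \<subseteq> Poly_Mapping.keys P" for T
    using that
  proof induction
    case empty
    then show ?case using mult_ideal_closed(1)[of m "{0}"] by (simp add: mult_ideal_def)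
  next
    case (insert t T)
    then show ?case by (simp add: vanishes_to_order_add vanishes_to_order_monomial assms)
  qed
  then show ?thesis by (subst expand_monomials) simp
qed

section \<open>The Hilbert function and cardinalities\<close>

text \<open>Counting counterpart of rank-nullity. It is applied to additive maps \<open>h\<close>,
  where subtracting one fixed element of a fibre embeds that fibre into the kernel.\<close>

lemma card_le_fibres:
  assumes "finite A" "finite B" "h ` A \<subseteq> B" "\<And>b. b \<in> B \<Longrightarrow> card {a \<in> A. h a = b} \<le> k"
  shows "card A \<le> card B * k"
proof -
  have "A = (\<Union>b\<in>B. {a \<in> A. h a = b})" using assms(3) by auto
  then have "card A \<le> (\<Sum>b\<in>B. card {a \<in> A. h a = b})"
    using card_UN_le[OF assms(2), of "\<lambda>b. {a \<in> A. h a = b}"] by simp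
  also have "\<dots> \<le> (\<Sum>b\<in>B. k)" by (rule sum_mono) (rule assms(4))
  finally show ?thesis by simp
qed

lemma mult_ideal_diff:
  assumes "P \<in> mult_ideal m X" "Q \<in> mult_ideal m X"
  shows "P - Q \<in> mult_ideal m X"
  using mult_ideal_closed(2)[OF assms(1) mult_ideal_closed(3)[OF assms(2), of "- 1"]] by simp

lemma deg_le_diff:
  assumes "P \<in> deg_le J d" "Q \<in> deg_le K d" "P - Q \<in> L"
  shows "P - Q \<in> deg_le L d"
  using assms keys_diff[of P Q] unfolding mem_deg_le_iff by blast

text \<open>The finite carrier generates the space, so a finite basis \<open>B\<close> exists, and
  coordinates with respect to \<open>B\<close> identify the carrier with the functions from
  \<open>B\<close> to the field.\<close>

lemma card_vectorspace:
  assumes "vectorspace (class_ring :: 'k::{finite,field} ring) V" "finite (carrier V)"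
  shows "card (carrier V) = CARD('k) ^ vectorspace.dim (class_ring :: 'k ring) V"
proof -
  interpret vectorspace "class_ring :: 'k ring" V by fact
  have "gen_set (carrier V)"
    using in_own_span[of "carrier V"] span_is_subset2[of "carrier V"] by auto
  then have fin_dim
    unfolding fin_dim_def using assms(2) by blast
  then obtain B where B: "finite B" "basis B" using finite_basis_exists by blast
  then have BV: "B \<subseteq> carrier V" by (simp add: basis_def)
  have ex1: "\<exists>!a. a \<in> B \<rightarrow>\<^sub>E (UNIV :: 'k set) \<and> lincomb a B = v" if "v \<in> carrier V" for v
    using basis_criterion[OF B(1) BV] B(2) that by simp
  have "bij_betw (\<lambda>a. lincomb a B) (B \<rightarrow>\<^sub>E (UNIV :: 'k set)) (carrier V)"
  proof (rule bij_betwI')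
    fix a b assume "a \<in> B \<rightarrow>\<^sub>E (UNIV :: 'k set)" "b \<in> B \<rightarrow>\<^sub>E (UNIV :: 'k set)"
    then show "lincomb a B = lincomb b B \<longleftrightarrow> a = b"
      using ex1[of "lincomb b B"] lincomb_closed[OF BV, of b] by auto
  next
    fix a assume "a \<in> B \<rightarrow>\<^sub>E (UNIV :: 'k set)"
    then show "lincomb a B \<in> carrier V" using lincomb_closed[OF BV, of a] by simp
  next
    fix v assume "v \<in> carrier V"
    then show "\<exists>a\<in>B \<rightarrow>\<^sub>E (UNIV :: 'k set). v = lincomb a B" using ex1 by blast
  qed
  then have "card (carrier V) = card (B \<rightarrow>\<^sub>E (UNIV :: 'k set))"
    by (rule bij_betw_same_card[symmetric])
  then show ?thesis
    using B by (simp add: card_funcsetE dim_basis)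
qed

text \<open>Lagrange's theorem for the subspace \<open>?W\<close> of \<open>?V\<close>: all cosets
  have \<open>card ?W\<close> elements, and their number is q to the dimension of the quotient. All
  later comparisons of Hilbert functions go through this identity.\<close>

lemma card_affine_HF:
  fixes S :: "('k::{finite,field} ^ 'n::finite) set"
  shows "card (deg_le UNIV d :: ('n, 'k) mpoly set)
    = CARD('k) ^ affine_HF m S d * card (deg_le (mult_ideal m S) d)"
proof -
  let ?V = "deg_le UNIV d :: ('n, 'k) mpoly set" and ?W = "deg_le (mult_ideal m S) d"
  let ?Q = "quotient_space (\<lambda>c P. Const c * P) ?V ?W"
  have Q: "carrier ?Q = (\<lambda>v. v +o ?W) ` ?V" by (simp add: quotient_space_def)
  have fibre: "card {u \<in> ?V. u +o ?W = v +o ?W} = card ?W" if v: "v \<in> ?V" for v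
  proof -
    have "{u \<in> ?V. u +o ?W = v +o ?W} = (+) v ` ?W"
    proof (intro equalityI subsetI)
      fix u assume "u \<in> {u \<in> ?V. u +o ?W = v +o ?W}"
      moreover have "u \<in> u +o ?W"
        by (force simp: elt_set_plus_def mem_deg_le_iff mult_ideal_closed)
      ultimately show "u \<in> (+) v ` ?W" by (auto simp: elt_set_plus_def)
    next
      fix u assume "u \<in> (+) v ` ?W"
      then obtain w where w: "w \<in> ?W" "u = v + w" by auto
      have plus: "w + w' \<in> ?W" if "w' \<in> ?W" for w'
        using w(1) that Poly_Mapping.keys_add[of w w'] mult_ideal_closed(2)
        unfolding mem_deg_le_iff by blast
      have minus: "w' - w \<in> ?W" if "w' \<in> ?W" for w'
        using that w(1) by (meson deg_le_diff mult_ideal_diff mem_deg_le_iff)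
      have "u \<in> ?V" using v w Poly_Mapping.keys_add[of v w] unfolding mem_deg_le_iff by blast
      moreover have "u +o ?W = v +o ?W"
      proof (intro equalityI subsetI)
        fix x assume "x \<in> u +o ?W"
        then show "x \<in> v +o ?W" using plus w(2) by (auto simp: elt_set_plus_def add.assoc)
      next
        fix x assume "x \<in> v +o ?W"
        then obtain w' where "w' \<in> ?W" "x = v + w'" by (auto simp: elt_set_plus_def)
        then have "x = u + (w' - w)" "w' - w \<in> ?W" using minus w(2) by auto
        then show "x \<in> u +o ?W" by (auto simp: elt_set_plus_def)
      qed
      ultimately show "u \<in> {u \<in> ?V. u +o ?W = v +o ?W}" by simp
    qed
    then show ?thesis by (simp add: card_image)
  qed
  have "card ?V = (\<Sum>C\<in>(\<lambda>v. v +o ?W) ` ?V. card {u \<in> ?V. u +o ?W = C})"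
    using sum.image_gen[OF finite_deg_le, of "\<lambda>_. 1::nat" UNIV d "\<lambda>v. v +o ?W"] by simp
  also have "\<dots> = (\<Sum>C\<in>(\<lambda>v. v +o ?W) ` ?V. card ?W)"
    using fibre by (intro sum.cong) auto
  also have "\<dots> = card (carrier ?Q) * card ?W" by (simp add: Q)
  also have "card (carrier ?Q) = CARD('k) ^ affine_HF m S d"
    unfolding affine_HF_def
    by (rule card_vectorspace[OF vectorspace_affine_HF]) (simp add: Q finite_deg_le)
  finally show ?thesis .
qed

lemma card_deg_le_mult_ideal_pos:
  "card (deg_le (mult_ideal m (S :: ('k::{finite,field} ^ 'n::finite) set)) d) > 0"
proof -
  have "0 \<in> deg_le (mult_ideal m S) d" by (simp add: mem_deg_le_iff mult_ideal_closed)
  then show ?thesis using finite_deg_le card_gt_0_iff by blast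
qed

section \<open>Submodularity, translation invariance and the bound by points\<close>

lemma CARD_field_gt_1: "1 < CARD('k::{finite,field})"
  using card_mono[of "UNIV :: 'k set" "{0, 1}"] by simp

text \<open>Subtraction maps \<open>?W S \<times> ?W T\<close> into
  \<open>?W (S \<inter> T)\<close>, and its kernel is the diagonal copy of the intersection of
  \<open>?W S\<close> and \<open>?W T\<close>, which is \<open>?W (S \<union> T)\<close>.\<close>

lemma card_deg_le_submodular:
  fixes S T :: "('k::{finite,field} ^ 'n::finite) set"
  shows "card (deg_le (mult_ideal m S) d) * card (deg_le (mult_ideal m T) d)
    \<le> card (deg_le (mult_ideal m (S \<inter> T)) d) * card (deg_le (mult_ideal m (S \<union> T)) d)"
proof -
  let ?W = "\<lambda>S :: ('k ^ 'n) set. deg_le (mult_ideal m S) d"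
  have mem: "P - Q \<in> ?W (S \<inter> T)" if "P \<in> ?W S" "Q \<in> ?W T" for P Q
  proof (rule deg_le_diff[OF that])
    have "P \<in> mult_ideal m (S \<inter> T)" "Q \<in> mult_ideal m (S \<inter> T)"
      using that by (auto simp: mem_deg_le_iff mult_ideal_def)
    then show "P - Q \<in> mult_ideal m (S \<inter> T)" by (rule mult_ideal_diff)
  qed
  have fibre: "card {a \<in> ?W S \<times> ?W T. fst a - snd a = b} \<le> card (?W (S \<union> T))" for b
  proof (cases "{a \<in> ?W S \<times> ?W T. fst a - snd a = b} = {}")
    case False
    then obtain P0 Q0 where P0: "P0 \<in> ?W S" "Q0 \<in> ?W T" "P0 - Q0 = b" by auto
    have "fst a - P0 \<in> ?W (S \<union> T)" if "a \<in> {a \<in> ?W S \<times> ?W T. fst a - snd a = b}" for a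
    proof (rule deg_le_diff)
      show "fst a \<in> ?W S" "P0 \<in> ?W S" using that P0 by auto
      \<comment> \<open>Both pairs have difference \<open>b\<close>. The common value is a
        difference inside \<open>?W S\<close> and also inside \<open>?W T\<close>, so it vanishes on
        both sets.\<close>
      have "fst a - P0 = snd a - Q0" using that P0 by (auto simp: algebra_simps)
      moreover have "fst a - P0 \<in> mult_ideal m S" "snd a - Q0 \<in> mult_ideal m T"
        using that P0 by (auto intro!: mult_ideal_diff simp: mem_deg_le_iff)
      ultimately show "fst a - P0 \<in> mult_ideal m (S \<union> T)"
        by (auto simp: mult_ideal_def)
    qed
    moreover have "inj_on (\<lambda>a. fst a - P0) {a \<in> ?W S \<times> ?W T. fst a - snd a = b}"
      by (auto simp: inj_on_def)
    ultimately show ?thesis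
      by (intro card_inj_on_le[OF _ _ finite_deg_le]) auto
  next
    case True
    then show ?thesis by (simp only: card.empty)
  qed
  have "card (?W S \<times> ?W T) \<le> card (?W (S \<inter> T)) * card (?W (S \<union> T))"
    by (rule card_le_fibres[where h = "\<lambda>a. fst a - snd a"])
      (use mem fibre in \<open>auto simp: finite_deg_le\<close>)
  then show ?thesis by (simp add: card_cartesian_product)
qed

text \<open>The square of the size of the full space is factored once through
  \<open>S \<union> T\<close> and \<open>S \<inter> T\<close> and once through \<open>S\<close> and
  \<open>T\<close>. The inequality between the ideal parts thereby reverses for the powers of q, and
  exponents can be compared as q > 1.\<close>

lemma affine_HF_submodular:
  fixes S T :: "('k::{finite,field} ^ 'n::finite) set"
  shows "affine_HF m (S \<union> T) d + affine_HF m (S \<inter> T) d \<le> affine_HF m S d + affine_HF m T d"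
proof -
  let ?f = "\<lambda>S :: ('k ^ 'n) set. affine_HF m S d"
    and ?w = "\<lambda>S :: ('k ^ 'n) set. card (deg_le (mult_ideal m S) d)"
  have "CARD('k) ^ (?f (S \<union> T) + ?f (S \<inter> T)) * (?w (S \<inter> T) * ?w (S \<union> T))
      = card (deg_le UNIV d :: ('n, 'k) mpoly set) ^ 2"
    using card_affine_HF[of d m "S \<union> T"] card_affine_HF[of d m "S \<inter> T"]
    by (simp add: power2_eq_square power_add ac_simps)
  also have "\<dots> = CARD('k) ^ (?f S + ?f T) * (?w S * ?w T)"
    using card_affine_HF[of d m S] card_affine_HF[of d m T]
    by (simp add: power2_eq_square power_add ac_simps)
  also have "\<dots> \<le> CARD('k) ^ (?f S + ?f T) * (?w (S \<inter> T) * ?w (S \<union> T))"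
    by (rule mult_left_mono[OF card_deg_le_submodular]) simp
  finally have "CARD('k) ^ (?f (S \<union> T) + ?f (S \<inter> T)) \<le> CARD('k) ^ (?f S + ?f T)"
    using card_deg_le_mult_ideal_pos[of m "S \<inter> T" d] card_deg_le_mult_ideal_pos[of m "S \<union> T" d]
    by simp
  then show ?thesis
    using power_le_imp_le_exp[OF CARD_field_gt_1] by blast
qed

lemma affine_HF_empty: "affine_HF m ({} :: ('k::{finite,field} ^ 'n::finite) set) d = 0"
proof -
  have "mult_ideal m ({} :: ('k ^ 'n) set) = UNIV" by (simp add: mult_ideal_def)
  then have "CARD('k) ^ affine_HF m ({} :: ('k ^ 'n) set) d = 1"
    using card_affine_HF[of d m "{} :: ('k ^ 'n) set"]
      card_deg_le_mult_ideal_pos[of m "{} :: ('k ^ 'n) set" d] by simp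
  then show ?thesis using CARD_field_gt_1[where ?'k = 'k] by (simp add: power_eq_1_iff)
qed

text \<open>The multiplicities \<open>a\<close> and \<open>b\<close> may differ, so that order
  \<open>l\<close> on the closure can be compared with order \<open>m\<close> on
  \<open>Y\<close>.\<close>

lemma affine_HF_le_of_card_le:
  fixes S T :: "('k::{finite,field} ^ 'n::finite) set"
  assumes "card (deg_le (mult_ideal a S) d) \<le> card (deg_le (mult_ideal b T) d)"
  shows "affine_HF b T d \<le> affine_HF a S d"
proof -
  have "CARD('k) ^ affine_HF b T d * card (deg_le (mult_ideal b T) d)
      = CARD('k) ^ affine_HF a S d * card (deg_le (mult_ideal a S) d)"
    using card_affine_HF[of d a S] card_affine_HF[of d b T] by simp
  also have "\<dots> \<le> CARD('k) ^ affine_HF a S d * card (deg_le (mult_ideal b T) d)"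
    by (rule mult_left_mono[OF assms]) simp
  finally have "CARD('k) ^ affine_HF b T d \<le> CARD('k) ^ affine_HF a S d"
    using card_deg_le_mult_ideal_pos[of b T d] by simp
  then show ?thesis using power_le_imp_le_exp[OF CARD_field_gt_1] by blast
qed

text \<open>Translation by \<open>- g\<close> preserves the degree bound and embeds the polynomials
  vanishing on \<open>S\<close> into those vanishing on g + S.\<close>

lemma affine_HF_translate_le:
  fixes S :: "('k::{finite,field} ^ 'n::finite) set"
  shows "affine_HF m ((+) g ` S) d \<le> affine_HF m S d"
proof (rule affine_HF_le_of_card_le, rule card_inj_on_le[OF _ _ finite_deg_le])
  show "inj_on (translate (- g)) (deg_le (mult_ideal m S) d)"
    by (metis inj_on_inverseI translate_uminus)
  show "translate (- g) ` deg_le (mult_ideal m S) d \<subseteq> deg_le (mult_ideal m ((+) g ` S)) d"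
  proof (rule image_subsetI)
    fix P assume P: "P \<in> deg_le (mult_ideal m S) d"
    have "vanishes_to_order m (g + x) (translate (- g) P)" if "x \<in> S" for x
      using vanishes_to_order_translate[of m x P "- g"] P that
      by (simp add: mem_deg_le_iff mult_ideal_def add.commute)
    then show "translate (- g) P \<in> deg_le (mult_ideal m ((+) g ` S)) d"
      using P keys_translate[of P d "- g"] by (simp add: mem_deg_le_iff mult_ideal_def)
  qed
qed

text \<open>At the origin, two polynomials with the same terms of degree below \<open>m\<close>
  differ by one vanishing to order \<open>m\<close>, so the number of such low-order parts bounds
  the size of the quotient. A translation then moves the origin to \<open>x\<close>.\<close>

lemma affine_HF_singleton_le:
  fixes x :: "'k::{finite,field} ^ 'n::finite"
  assumes "m \<ge> 1"
  shows "affine_HF m {x} d \<le> (m + CARD('n) - 1) choose CARD('n)"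
proof -
  let ?E = "exponents (m - 1) :: ('n \<Rightarrow>\<^sub>0 nat) set"
  let ?V = "deg_le UNIV d :: ('n, 'k) mpoly set"
    and ?W = "deg_le (mult_ideal m {0 :: 'k ^ 'n}) d"
    and ?B = "{P :: ('n, 'k) mpoly. Poly_Mapping.keys P \<subseteq> ?E}"
  \<comment> \<open>Truncation to degree at most \<open>m - 1\<close>; as \<open>m \<ge> 1\<close>,
    this means exactly degree below \<open>m\<close>.\<close>
  define h :: "('n, 'k) mpoly \<Rightarrow> ('n, 'k) mpoly"
    where "h P = (\<Sum>t\<in>?E. Poly_Mapping.single t (Poly_Mapping.lookup P t))" for P
  have h: "Poly_Mapping.lookup (h P) t = (if t \<in> ?E then Poly_Mapping.lookup P t else 0)" for P t
    using exponents_card(1)[of "m - 1", where ?'n = 'n]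
    by (simp add: h_def lookup_sum lookup_single when_def)
  have fibre: "card {P \<in> ?V. h P = b} \<le> card ?W" for b
  proof (cases "{P \<in> ?V. h P = b} = {}")
    case False
    then obtain P0 where P0: "P0 \<in> ?V" "h P0 = b" by auto
    have "P - P0 \<in> ?W" if "P \<in> {P \<in> ?V. h P = b}" for P
    proof (rule deg_le_diff)
      have "m \<le> (\<Sum>i\<in>UNIV. Poly_Mapping.lookup t i)" if t: "t \<in> Poly_Mapping.keys (P - P0)" for t
      proof (rule ccontr)
        assume "\<not> ?thesis"
        then have "t \<in> ?E" using assms by (auto simp: exponents_def)
        moreover have "h P = h P0" using \<open>P \<in> _\<close> P0 by simp
        ultimately have "Poly_Mapping.lookup P t = Poly_Mapping.lookup P0 t" using h by metis
        then show False using t by (simp add: in_keys_iff lookup_minus)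
      qed
      then show "P - P0 \<in> mult_ideal m {0}"
        using vanishes_to_order_origin by (auto simp: mult_ideal_def)
    qed (use that P0 in auto)
    then have "(\<lambda>P. P - P0) ` {P \<in> ?V. h P = b} \<subseteq> ?W" by (rule image_subsetI)
    moreover have "inj_on (\<lambda>P. P - P0) {P \<in> ?V. h P = b}" by (simp add: inj_on_def)
    ultimately show ?thesis by (intro card_inj_on_le[OF _ _ finite_deg_le])
  next
    case True
    then show ?thesis by (simp only: card.empty)
  qed
  have "Poly_Mapping.keys (h P) \<subseteq> ?E" for P
    by (auto simp: in_keys_iff h split: if_splits)
  then have "card ?V \<le> card ?B * card ?W"
    by (intro card_le_fibres[where h = h] fibre finite_deg_le
        polys_with_keys_card exponents_card) auto
  also have "\<dots> \<le> CARD('k) ^ card ?E * card ?W"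
    by (intro mult_right_mono polys_with_keys_card exponents_card) simp
  finally have "CARD('k) ^ affine_HF m {0 :: 'k ^ 'n} d \<le> CARD('k) ^ card ?E"
    using card_affine_HF[of d m "{0 :: 'k ^ 'n}"] card_deg_le_mult_ideal_pos[of m "{0 :: 'k ^ 'n}" d]
    by simp
  then have "affine_HF m {0 :: 'k ^ 'n} d \<le> card ?E"
    using power_le_imp_le_exp[OF CARD_field_gt_1] by blast
  also have "\<dots> \<le> (m + CARD('n) - 1) choose CARD('n)"
    using exponents_card(2)[of "m - 1", where ?'n = 'n] assms by simp
  finally show ?thesis
    using affine_HF_translate_le[of m x "{0}" d] by simp
qed

text \<open>Submodularity gives subadditivity once the nonnegative intersection term is dropped, so
  each added point costs at most one binomial coefficient.\<close>

lemma affine_HF_le: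
  fixes Y :: "('k::{finite,field} ^ 'n::finite) set"
  assumes "m \<ge> 1"
  shows "affine_HF m Y d \<le> ((m + CARD('n) - 1) choose CARD('n)) * card Y"
  using finite_class.finite[of Y]
proof (induction Y rule: finite_induct)
  case empty
  then show ?case by (simp add: affine_HF_empty)
next
  case (insert y Y)
  then show ?case
    using affine_HF_submodular[of m Y "{y}" d] affine_HF_singleton_le[OF assms, of y d] by simp
qed

section \<open>Covering by translates\<close>

text \<open>\<open>F\<close> is built up point by point. By diminishing returns, a new point
  \<open>x\<close> raises \<open>f\<close> on \<open>S i \<inter> F\<close> at least as much as on
  \<open>F\<close> whenever \<open>x \<in> S i\<close>, and this happens for exactly
  \<open>k\<close> indices.\<close>

lemma submodular_cover:
  fixes f :: "'a set \<Rightarrow> nat"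
  assumes sub: "\<And>A B. f (A \<union> B) + f (A \<inter> B) \<le> f A + f B" and "f {} = 0"
    and "finite I" "finite F"
    and cover: "\<And>x. x \<in> F \<Longrightarrow> card {i \<in> I. x \<in> S i} = k"
  shows "k * f F \<le> (\<Sum>i\<in>I. f (S i \<inter> F))"
  using \<open>finite F\<close> cover
proof (induction F rule: finite_induct)
  case empty
  then show ?case by (simp add: assms)
next
  case (insert x F)
  \<comment> \<open>The comparison of increments is kept additive to avoid truncated subtraction. If
    \<open>x\<close> is not in \<open>S i\<close>, the traces on \<open>F\<close> and on
    \<open>insert x F\<close> coincide.\<close>
  have "f (S i \<inter> F) + (if x \<in> S i then f (insert x F) else 0)
      \<le> f (S i \<inter> insert x F) + (if x \<in> S i then f F else 0)" for i
  proof (cases "x \<in> S i")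
    case True
    then have "(S i \<inter> insert x F) \<union> F = insert x F" "(S i \<inter> insert x F) \<inter> F = S i \<inter> F"
      using insert.hyps by auto
    then show ?thesis using sub[of "S i \<inter> insert x F" F] True by simp
  qed simp
  then have "(\<Sum>i\<in>I. f (S i \<inter> F) + (if x \<in> S i then f (insert x F) else 0))
      \<le> (\<Sum>i\<in>I. f (S i \<inter> insert x F) + (if x \<in> S i then f F else 0))"
    by (rule sum_mono)
  then have "(\<Sum>i\<in>I. f (S i \<inter> F)) + k * f (insert x F) \<le> (\<Sum>i\<in>I. f (S i \<inter> insert x F)) + k * f F"
    using insert.prems[of x] \<open>finite I\<close>
    by (simp add: sum.distrib flip: sum.inter_filter)
  then show ?case using insert by fastforce
qed

lemma affine_HF_UNIV_le:
  fixes X :: "('k::{finite,field} ^ 'n::finite) set"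
  shows "affine_HF l (UNIV :: ('k ^ 'n) set) d * card X \<le> CARD('k ^ 'n) * affine_HF l X d"
proof -
  have "card {g \<in> UNIV. x \<in> (+) g ` X} = card X" for x
  proof -
    \<comment> \<open>The translates g + X containing \<open>x\<close> are those with g = x - y for
      some y in X, one for each y.\<close>
    have "{g \<in> UNIV. x \<in> (+) g ` X} = (\<lambda>y. x - y) ` X"
      by (auto simp: image_iff algebra_simps)
    then show ?thesis by (simp add: card_image inj_on_def)
  qed
  \<comment> \<open>The covering inequality with all translates of \<open>X\<close> as the family,
    the whole space as \<open>F\<close> and k = \<open>card X\<close>.\<close>
  then have "card X * affine_HF l (UNIV :: ('k ^ 'n) set) d
      \<le> (\<Sum>g\<in>UNIV. affine_HF l ((+) g ` X \<inter> UNIV) d)"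
    by (intro submodular_cover affine_HF_submodular affine_HF_empty) simp_all
  also have "\<dots> \<le> (\<Sum>g\<in>(UNIV :: ('k ^ 'n) set). affine_HF l X d)"
    by (intro sum_mono) (simp add: affine_HF_translate_le)
  finally show ?thesis by (simp add: mult.commute)
qed

theorem theorem6p13:
  fixes Y X :: "('k::{finite, field} ^ 'n::finite) set"
    and l m d q n :: nat
  assumes "q = CARD('k)" and "n = CARD('n)"
    and "l \<ge> 1" and "m \<ge> 1"
    and "X = mult_closure d l m Y"
  shows "affine_HF l (UNIV :: ('k ^ 'n) set) d * card X \<le> q ^ n * ((m + n - 1) choose n) * card Y"
proof -
  \<comment> \<open>This is the defining property of the closure. A larger space of vanishing
    polynomials means a smaller Hilbert function, which bounds \<open>X\<close> by
    \<open>Y\<close>.\<close>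
  have "deg_le (mult_ideal m Y) d \<subseteq> deg_le (mult_ideal l X) d"
    using assms(5) by (auto simp: mem_deg_le_iff mult_closure_def mult_ideal_def)
  then have "affine_HF l X d \<le> affine_HF m Y d"
    by (intro affine_HF_le_of_card_le card_mono finite_deg_le)
  also have "\<dots> \<le> ((m + n - 1) choose n) * card Y"
    using affine_HF_le[OF assms(4), of Y d] by (simp add: assms(2))
  finally have "q ^ n * affine_HF l X d \<le> q ^ n * ((m + n - 1) choose n) * card Y"
    by (simp add: mult.assoc)
  moreover have "affine_HF l (UNIV :: ('k ^ 'n) set) d * card X \<le> q ^ n * affine_HF l X d"
    using affine_HF_UNIV_le[of l d X] by (simp add: assms(1,2))
  ultimately show ?thesis by (rule order_trans[rotated])
qed

end
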